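(* Let $\phi$ be a holomorphic function on an open subset $U\subset\mathbb{C}^2$ of the form $\phi(z_1,z_2)=a z_1+b(z_2)$, where $a\in\mathbb{C}$ is a constant and $b$ is a holomorphic function of $z_2$. Let $L_\phi=\big\{\big(z_1,z_2,\frac{\partial\phi}{\partial z_1},\frac{\partial\phi}{\partial z_2}\big):(z_1,z_2)\in U\big\}\subset\mathbb{C}^4$ and let $G:T^*\mathbb{R}^4\to\mathbb{C}^4$ be the map $$G(q,p)=(p_1-ip_2,\;q_3+iq_4,\;-q_1-iq_2,\;p_3-ip_4).$$ Then $G^{-1}(L_\phi)$ is a generalized solution of the Plebanski I equation.
   Context: $T^*\mathbb{R}^4\cong\mathbb{R}^8$ has coordinates $(q,p)=(q_1,\dots,q_4,p_1,\dots,p_4)$ and symplectic form $\Omega=\sum_{j=1}^4 dq_j\wedge dp_j$. The Plebanski I equation for a function $f$ on $\mathbb{R}^4$ is $$\frac{\partial^2 f}{\partial q_1\partial q_3}\frac{\partial^2 f}{\partial q_2\partial q_4}-\frac{\partial^2 f}{\partial q_1\partial q_4}\frac{\partial^2 f}{\partial q_2\partial q_3}=1 .$$ It corresponds to the $4$-form $$\omega_{PI}=dq_1\wedge dq_2\wedge dp_1\wedge dp_2-dq_1\wedge dq_2\wedge dq_3\wedge dq_4,$$ in the sense that $f$ is a solution iff $(df)^*\omega_{PI}=0$. A generalized solution of the Plebanski I equation is a lagrangian submanifold $L$ of $(T^*\mathbb{R}^4,\Omega)$ (i.e. $\dim_{\mathbb{R}}L=4$ and $\Omega|_L=0$) such that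 $\omega_{PI}|_L=0$. *)

theory Defs
  imports "HOL-Complex_Analysis.Complex_Analysis" "HOL-Combinatorics.Permutations"
begin

section \<open>Smooth maps, submanifolds and tangent vectors in Euclidean space\<close>

text \<open>Only meant for open \<open>S\<close>. On finite-dimensional spaces, a map is $C^{k+1}$ iff it is
  differentiable and all its directional derivatives are $C^k$.\<close>

primrec Ck_on :: "nat \<Rightarrow> ('a::euclidean_space \<Rightarrow> 'b::real_normed_vector) \<Rightarrow> 'a set \<Rightarrow> bool" where
  "Ck_on 0 f S \<longleftrightarrow> continuous_on S f"
| "Ck_on (Suc k) f S \<longleftrightarrow>
     (\<forall>x\<in>S. f differentiable (at x)) \<and> (\<forall>v. Ck_on k (\<lambda>x. frechet_derivative f (at x) v) S)"

definition smooth_on :: "('a::euclidean_space \<Rightarrow> 'b::real_normed_vector) \<Rightarrow> 'a set \<Rightarrow> bool" where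
  "smooth_on f S \<longleftrightarrow> (\<forall>k. Ck_on k f S)"

text \<open>Embedded smooth submanifolds without boundary, via slice charts. As usual, the empty set
  is a submanifold of every dimension.\<close>

definition embedded_submanifold :: "nat \<Rightarrow> 'a::euclidean_space set \<Rightarrow> bool" where
  "embedded_submanifold d M \<longleftrightarrow>
     (\<forall>x\<in>M. \<exists>W V (\<Phi> :: 'a \<Rightarrow> 'a) \<Psi> S.
        open W \<and> x \<in> W \<and> open V \<and> homeomorphism W V \<Phi> \<Psi> \<and> smooth_on \<Phi> W \<and> smooth_on \<Psi> V \<and>
        subspace S \<and> dim S = d \<and> \<Phi> ` (W \<inter> M) = V \<inter> S)"

definition tangent_space :: "'a::euclidean_space set \<Rightarrow> 'a \<Rightarrow> 'a set" where
  "tangent_space M x =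
     {v. \<exists>(\<gamma> :: real \<Rightarrow> 'a) \<epsilon>. \<epsilon> > 0 \<and> smooth_on \<gamma> {-\<epsilon><..<\<epsilon>} \<and> \<gamma> ` {-\<epsilon><..<\<epsilon>} \<subseteq> M \<and>
           \<gamma> 0 = x \<and> (\<gamma> has_vector_derivative v) (at 0)}"


section \<open>Constant-coefficient exterior forms\<close>

text \<open>A constant-coefficient \<open>k\<close>-form is represented as a function on lists of \<open>k\<close> vectors;
  its values on lists of other lengths are irrelevant.
  \<open>wedge [\<alpha>\<^sub>1, \<dots>, \<alpha>\<^sub>k] [v\<^sub>1, \<dots>, v\<^sub>k]\<close> is the determinant of the matrix \<open>\<alpha>\<^sub>i v\<^sub>j\<close>.\<close>

definition wedge :: "('a \<Rightarrow> real) list \<Rightarrow> 'a list \<Rightarrow> real" where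
  "wedge \<alpha>s vs =
     (\<Sum>\<pi> | \<pi> permutes {..<length \<alpha>s}.
        of_int (sign \<pi>) * (\<Prod>i<length \<alpha>s. (\<alpha>s ! i) (vs ! \<pi> i)))"

definition restricts_to_zero :: "nat \<Rightarrow> ('a::euclidean_space list \<Rightarrow> real) \<Rightarrow> 'a set \<Rightarrow> bool" where
  "restricts_to_zero k \<omega> M \<longleftrightarrow>
     (\<forall>x\<in>M. \<forall>vs. length vs = k \<and> set vs \<subseteq> tangent_space M x \<longrightarrow> \<omega> vs = 0)"


section \<open>Generalized solutions of the Plebanski I equation\<close>

text \<open>Points of \<open>T\<^sup>*\<real>\<^sup>4\<close> are pairs \<open>(q, p)\<close>. In the index type \<open>4\<close> the numeral \<open>4\<close> equals \<open>0\<close>,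
  so \<open>1, 2, 3, 4\<close> are its four elements.\<close>

type_synonym cotangent4 = "(real^4) \<times> (real^4)"

definition dq :: "4 \<Rightarrow> cotangent4 \<Rightarrow> real" where
  "dq j v = fst v $ j"

definition dp :: "4 \<Rightarrow> cotangent4 \<Rightarrow> real" where
  "dp j v = snd v $ j"

definition Omega :: "cotangent4 list \<Rightarrow> real" where
  "Omega vs = (\<Sum>j\<in>UNIV. wedge [dq j, dp j] vs)"

text \<open>Pulled back along the graph \<open>p = df(q)\<close>, this form is
  $(f_{13} f_{24} - f_{14} f_{23} - 1)\, dq_1 \wedge dq_2 \wedge dq_3 \wedge dq_4$, where
  $f_{ij} = \partial^2 f / \partial q_i \partial q_j$; its vanishing is the Plebanski I equation.\<close>

definition omega_PI :: "cotangent4 list \<Rightarrow> real" where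
  "omega_PI vs = wedge [dq 1, dq 2, dp 1, dp 2] vs - wedge [dq 1, dq 2, dq 3, dq 4] vs"

definition lagrangian_submanifold :: "cotangent4 set \<Rightarrow> bool" where
  "lagrangian_submanifold L \<longleftrightarrow> embedded_submanifold 4 L \<and> restricts_to_zero 2 Omega L"

definition generalized_solution_PI :: "cotangent4 set \<Rightarrow> bool" where
  "generalized_solution_PI L \<longleftrightarrow> lagrangian_submanifold L \<and> restricts_to_zero 4 omega_PI L"


section \<open>Holomorphic functions of several variables and the graph of their differential\<close>

definition holomorphic_several_on :: "(complex^'n \<Rightarrow> complex) \<Rightarrow> (complex^'n) set \<Rightarrow> bool" where
  "holomorphic_several_on f U \<longleftrightarrow>
     (\<forall>z\<in>U. \<exists>D. (f has_derivative D) (at z) \<and> (\<forall>c v. D (c *s v) = c * D v))"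

definition partial_deriv :: "'n \<Rightarrow> (complex^'n \<Rightarrow> complex) \<Rightarrow> complex^'n \<Rightarrow> complex" where
  "partial_deriv j f z = deriv (\<lambda>w. f (\<chi> i. if i = j then w else z $ i)) (z $ j)"

definition differential_graph :: "(complex^2 \<Rightarrow> complex) \<Rightarrow> (complex^2) set \<Rightarrow> (complex^4) set" where
  "differential_graph \<phi> U =
     {vector [z $ 1, z $ 2, partial_deriv 1 \<phi> z, partial_deriv 2 \<phi> z] | z. z \<in> U}"

definition G :: "cotangent4 \<Rightarrow> complex^4" where
  "G = (\<lambda>(q, p). vector
     [complex_of_real (p $ 1) - \<i> * complex_of_real (p $ 2),
      complex_of_real (q $ 3) + \<i> * complex_of_real (q $ 4),
      - complex_of_real (q $ 1) - \<i> * complex_of_real (q $ 2),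
      complex_of_real (p $ 3) - \<i> * complex_of_real (p $ 4)])"

end

theory Submission
  imports Defs
begin

no_notation fps_nth (infixl "$" 75)

text \<open>Write \<open>Z = q\<^sub>3 + i q\<^sub>4\<close>. The preimage is cut out of an open set by \<open>q\<^sub>1 + i q\<^sub>2 = -a\<close> and
  \<open>p\<^sub>3 - i p\<^sub>4 = b' Z\<close>. The shear \<open>(q, p) \<mapsto> (q\<^sub>1 + Re a, q\<^sub>2 + Im a, q\<^sub>3, q\<^sub>4, p\<^sub>1, p\<^sub>2, p\<^sub>3 - Re (b' Z), p\<^sub>4 + Im (b' Z))\<close>
  flattens it to a coordinate 4-plane. On tangent vectors \<open>dq\<^sub>1\<close> and \<open>dq\<^sub>2\<close> vanish, which kills \<open>\<omega>\<^sub>P\<^sub>I\<close>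
  and reduces \<open>\<Omega>\<close> to \<open>dq\<^sub>3 \<and> dp\<^sub>3 + dq\<^sub>4 \<and> dp\<^sub>4 = Re (dZ \<and> d(p\<^sub>3 - i p\<^sub>4))\<close>; since
  \<open>d(p\<^sub>3 - i p\<^sub>4) = b'' Z dZ\<close> on tangent vectors, that vanishes as well.\<close>

section \<open>Calculus of C^k maps on open sets, up to slice charts given by shears\<close>

lemma Ck_on_cong:
  assumes "open S" "\<And>x. x \<in> S \<Longrightarrow> f x = g x" "Ck_on k f S"
  shows "Ck_on k g S"
  using assms(2,3)
proof (induction k arbitrary: f g)
  case 0
  then show ?case by (auto cong: continuous_on_cong)
next
  case (Suc k)
  have D: "(g has_derivative frechet_derivative f (at x)) (at x)" if "x \<in> S" for x
  proof (rule has_derivative_transform_within_open[OF _ assms(1) that])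
    show "(f has_derivative frechet_derivative f (at x)) (at x)"
      using Suc.prems that by (simp add: frechet_derivative_works)
  qed (use Suc.prems in auto)
  show ?case unfolding Ck_on.simps
  proof (intro conjI ballI allI)
    show "g differentiable at x" if "x \<in> S" for x
      using D[OF that] by (auto simp: differentiable_def)
    show "Ck_on k (\<lambda>x. frechet_derivative g (at x) v) S" for v
    proof (rule Suc.IH)
      show "frechet_derivative f (at x) v = frechet_derivative g (at x) v" if "x \<in> S" for x
        using frechet_derivative_at[OF D[OF that]] by simp
      show "Ck_on k (\<lambda>x. frechet_derivative f (at x) v) S" using Suc.prems by simp
    qed
  qed
qed

text \<open>Trades the chosen \<open>frechet_derivative\<close> for an explicit \<open>f' x\<close>:
  the two agree on \<open>S\<close> by uniqueness of derivatives, and openness of \<open>S\<close>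
  lets \<open>Ck_on_cong\<close> transfer regularity. The later inductions on \<open>k\<close> run
  through this rule.\<close>

lemma Ck_on_SucI:
  assumes "open S" "\<And>x. x \<in> S \<Longrightarrow> (f has_derivative f' x) (at x)"
    "\<And>v. Ck_on k (\<lambda>x. f' x v) S"
  shows "Ck_on (Suc k) f S"
  unfolding Ck_on.simps
proof (intro conjI ballI allI)
  show "f differentiable at x" if "x \<in> S" for x
    using assms(2)[OF that] by (auto simp: differentiable_def)
  show "Ck_on k (\<lambda>x. frechet_derivative f (at x) v) S" for v
  proof (rule Ck_on_cong[OF assms(1) _ assms(3)[of v]])
    show "f' x v = frechet_derivative f (at x) v" if "x \<in> S" for x
      using frechet_derivative_at[OF assms(2)[OF that]] by simp
  qed
qed

lemma Ck_on_const:
  assumes "open S"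
  shows "Ck_on k (\<lambda>x. c) S"
proof (induction k arbitrary: c)
  case (Suc k)
  show ?case by (rule Ck_on_SucI[OF assms has_derivative_const Suc])
qed simp

lemma Ck_on_bounded_linear:
  assumes "open S" "bounded_linear L"
  shows "Ck_on k L S"
proof (cases k)
  case 0
  then show ?thesis using assms by (simp add: linear_continuous_on)
next
  case (Suc n)
  then show ?thesis
    using Ck_on_SucI[OF assms(1) bounded_linear_imp_has_derivative[OF assms(2)] Ck_on_const[OF assms(1)]]
    by simp
qed

lemma Ck_on_add:
  assumes "open S" "Ck_on k f S" "Ck_on k g S"
  shows "Ck_on k (\<lambda>x. f x + g x) S"
  using assms(2,3)
proof (induction k arbitrary: f g)
  case 0
  then show ?case by (simp add: continuous_on_add)
next
  case (Suc k)
  show ?case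
    by (rule Ck_on_SucI[OF assms(1), where f' = "\<lambda>x v. frechet_derivative f (at x) v + frechet_derivative g (at x) v"])
      (use Suc in \<open>auto intro!: has_derivative_add simp: frechet_derivative_works\<close>)
qed

lemma Ck_on_bounded_linear_compose:
  assumes "open S" "bounded_linear L" "Ck_on k f S"
  shows "Ck_on k (\<lambda>x. L (f x)) S"
  using assms(3)
proof (induction k arbitrary: f)
  case 0
  then show ?case by (simp add: bounded_linear.continuous_on[OF assms(2)])
next
  case (Suc k)
  show ?case
    by (rule Ck_on_SucI[OF assms(1), where f' = "\<lambda>x v. L (frechet_derivative f (at x) v)"])
      (use Suc in \<open>auto intro!: bounded_linear.has_derivative[OF assms(2)] simp: frechet_derivative_works\<close>)
qed

text \<open>For fixed \<open>v\<close> the derivative is the constant \<open>A v\<close> times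
  \<open>deriv g\<close> composed with \<open>A\<close>, and \<open>deriv g\<close> is again
  holomorphic on \<open>T\<close>. So the induction closes once \<open>g\<close> is
  generalized.\<close>

lemma Ck_on_holomorphic_linear:
  assumes "open S" "open T" "bounded_linear A" "A ` S \<subseteq> T" "g holomorphic_on T"
  shows "Ck_on k (\<lambda>x. g (A x)) S"
  using assms(5)
proof (induction k arbitrary: g)
  case 0
  have "continuous_on (A ` S) g"
    using 0 assms(4) holomorphic_on_imp_continuous_on continuous_on_subset by blast
  then show ?case
    using continuous_on_compose2[OF _ linear_continuous_on[OF assms(3)]] by auto
next
  case (Suc k)
  show ?case
  proof (rule Ck_on_SucI[OF assms(1), where f' = "\<lambda>x v. deriv g (A x) * A v"])
    show "((\<lambda>x. g (A x)) has_derivative (\<lambda>v. deriv g (A x) * A v)) (at x)" if "x \<in> S" for x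
    proof -
      have "(g has_field_derivative deriv g (A x)) (at (A x))"
        using Suc.prems assms(2,4) that by (auto intro: holomorphic_derivI)
      then have "(g has_derivative (*) (deriv g (A x))) (at (A x))"
        by (simp add: has_field_derivative_def)
      from has_derivative_compose[OF bounded_linear_imp_has_derivative[OF assms(3)] this]
      show ?thesis .
    qed
    show "Ck_on k (\<lambda>x. deriv g (A x) * A v) S" for v
      by (rule Ck_on_bounded_linear_compose[OF assms(1) bounded_linear_mult_left])
        (rule Suc.IH[OF holomorphic_deriv[OF Suc.prems assms(2)]])
  qed
qed

text \<open>Since \<open>h\<close> does not change under a shift by its own value,
  \<open>x - h x\<close> inverts \<open>x + h x\<close>. Both maps preserve \<open>W\<close>, so
  this single shear is a slice chart around every point of \<open>M\<close>.\<close>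

lemma embedded_submanifold_shear:
  fixes h :: "'a::euclidean_space \<Rightarrow> 'a"
  assumes "open W" "M \<subseteq> W" "smooth_on h W" "subspace S" "dim S = d"
    and M: "\<And>x. x \<in> W \<Longrightarrow> x \<in> M \<longleftrightarrow> x + h x \<in> S"
    and add: "\<And>x. x \<in> W \<Longrightarrow> x + h x \<in> W \<and> h (x + h x) = h x"
    and diff: "\<And>x. x \<in> W \<Longrightarrow> x - h x \<in> W \<and> h (x - h x) = h x"
  shows "embedded_submanifold d M"
  unfolding embedded_submanifold_def
proof (intro ballI exI conjI)
  have C: "Ck_on k h W" for k
    using assms(3) by (simp add: smooth_on_def)
  have I: "Ck_on k (\<lambda>x. x) W" for k
    by (rule Ck_on_bounded_linear[OF \<open>open W\<close> bounded_linear_ident])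
  show "smooth_on (\<lambda>x. x + h x) W"
    unfolding smooth_on_def using Ck_on_add[OF \<open>open W\<close> I C] by blast
  show "smooth_on (\<lambda>x. x - h x) W"
    unfolding smooth_on_def
    using Ck_on_add[OF \<open>open W\<close> I Ck_on_bounded_linear_compose[OF \<open>open W\<close>
          bounded_linear_minus[OF bounded_linear_ident] C]] by simp
  have "continuous_on W h" using C[of 0] by simp
  then show "homeomorphism W W (\<lambda>x. x + h x) (\<lambda>x. x - h x)"
    using add diff by (intro homeomorphismI continuous_intros) auto
  show "(\<lambda>x. x + h x) ` (W \<inter> M) = W \<inter> S"
  proof (intro equalityI subsetI)
    fix y assume y: "y \<in> W \<inter> S"
    then have "y = (y - h y) + h (y - h y)" "y - h y \<in> W"
      using diff by auto
    with y M show "y \<in> (\<lambda>x. x + h x) ` (W \<inter> M)"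
      by (metis IntD2 IntI image_eqI)
  qed (use M add in auto)
qed (use assms in auto)

section \<open>Differentiation along tangent vectors\<close>

lemma tangent_space_cases:
  assumes "v \<in> tangent_space M x"
  obtains \<gamma> where "\<gamma> 0 = x" "(\<gamma> has_vector_derivative v) (at 0)" "\<forall>\<^sub>F t in at 0. \<gamma> t \<in> M"
proof -
  obtain \<gamma> and \<epsilon> :: real where *: "\<epsilon> > 0" "\<gamma> ` {-\<epsilon><..<\<epsilon>} \<subseteq> M" "\<gamma> 0 = x"
    "(\<gamma> has_vector_derivative v) (at 0)"
    using assms unfolding tangent_space_def by blast
  have "\<forall>\<^sub>F t in at 0. t \<in> {-\<epsilon><..<\<epsilon>}"
    using * by (intro eventually_at_in_open') auto
  then have "\<forall>\<^sub>F t in at 0. \<gamma> t \<in> M"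
    by eventually_elim (use * in auto)
  with * show thesis using that by blast
qed

text \<open>Along a curve in \<open>M\<close> with velocity \<open>v\<close> the functions
  \<open>f\<close> and \<open>g\<close> coincide near time 0, so their derivatives there coincide.
  This turns an equation valid only on \<open>M\<close> into a linear equation for its tangent
  vectors.\<close>

lemma tangent_space_derivative_eq:
  assumes v: "v \<in> tangent_space M x" and "x \<in> M"
    and eq: "\<And>y. y \<in> M \<Longrightarrow> f y = g y"
    and f: "(f has_derivative f') (at x)" and g: "(g has_derivative g') (at x)"
  shows "f' v = g' v"
proof -
  obtain \<gamma> where \<gamma>: "\<gamma> 0 = x" "(\<gamma> has_vector_derivative v) (at 0)" "\<forall>\<^sub>F t in at 0. \<gamma> t \<in> M"
    using tangent_space_cases[OF v] by blast
  have comp: "((\<lambda>t. k (\<gamma> t)) has_vector_derivative k' v) (at 0)"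
    if "(k has_derivative k') (at x)" for k k'
    using vector_derivative_diff_chain_within[OF \<gamma>(2), of k k'] that \<gamma>(1)
    by (auto simp: o_def intro: has_derivative_at_withinI)
  have "((\<lambda>t. f (\<gamma> t)) has_vector_derivative g' v) (at 0)"
    using comp[OF g] unfolding has_vector_derivative_def
    by (rule has_derivative_transform_eventually)
      (use \<gamma> \<open>x \<in> M\<close> eq in \<open>auto elim: eventually_mono\<close>)
  then show ?thesis
    using comp[OF f] vector_derivative_unique_at by blast
qed

section \<open>Evaluation of wedge products\<close>

lemma wedge_eq_0:
  assumes "length vs = length \<alpha>s" "\<alpha> \<in> set \<alpha>s" "\<And>v. v \<in> set vs \<Longrightarrow> \<alpha> v = 0"
  shows "wedge \<alpha>s vs = 0"
  unfolding wedge_def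
proof (intro sum.neutral ballI)
  fix \<pi> assume "\<pi> \<in> {\<pi>. \<pi> permutes {..<length \<alpha>s}}"
  then have \<pi>: "\<pi> permutes {..<length \<alpha>s}" by simp
  \<comment> \<open>Row \<open>i\<close> of the determinant is zero, and every permutation
    contributes a factor from that row.\<close>
  obtain i where i: "i < length \<alpha>s" "\<alpha>s ! i = \<alpha>"
    using assms(2) by (metis in_set_conv_nth)
  have "\<pi> i < length vs"
    using permutes_in_image[OF \<pi>, of i] i assms(1) by simp
  then have "(\<alpha>s ! i) (vs ! \<pi> i) = 0"
    using assms(3) i by simp
  then have "(\<Prod>i<length \<alpha>s. (\<alpha>s ! i) (vs ! \<pi> i)) = 0"
    using i by (auto simp: prod_zero_iff)
  then show "of_int (sign \<pi>) * (\<Prod>i<length \<alpha>s. (\<alpha>s ! i) (vs ! \<pi> i)) = 0" by simp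
qed

lemma wedge_2: "wedge [\<alpha>, \<beta>] [x, y] = \<alpha> x * \<beta> y - \<alpha> y * \<beta> x"
proof -
  have *: "{..<length [\<alpha>, \<beta>]} = insert 0 {Suc 0}" by auto
  show ?thesis
    unfolding wedge_def *
    by (subst sum_over_permutations_insert)
      (auto simp: sign_swap_id sign_id permutes_sing swap_id_eq)
qed

section \<open>Coordinates and partial derivatives\<close>

lemma vector_4:
  fixes x y z w :: "'a::zero"
  shows "(vector [x, y, z, w] :: 'a^4) $ 1 = x" "(vector [x, y, z, w] :: 'a^4) $ 2 = y"
    "(vector [x, y, z, w] :: 'a^4) $ 3 = z" "(vector [x, y, z, w] :: 'a^4) $ 4 = w"
  unfolding vector_def by simp_all

lemma partial_deriv_affine_first:
  fixes U :: "(complex^2) set"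
  assumes "open U" "z \<in> U" "\<And>z. z \<in> U \<Longrightarrow> \<phi> z = a * z $ 1 + b (z $ 2)"
  shows "partial_deriv 1 \<phi> z = a" and "partial_deriv 2 \<phi> z = deriv b (z $ 2)"
proof -
  \<comment> \<open>The formula for \<phi> holds only on \<open>U\<close>; openness keeps nearby
    points of each coordinate line inside \<open>U\<close>, so the formula may be
    differentiated.\<close>
  have ev: "\<forall>\<^sub>F w in nhds (z $ j). (\<chi> i. if i = j then w else z $ i) \<in> U" for j
  proof -
    have "(\<lambda>w. \<chi> i. if i = j then w else z $ i) \<midarrow>z $ j\<rightarrow> (\<chi> i. if i = j then z $ j else z $ i)"
      by (intro tendsto_vec_lambda) auto
    moreover have z: "(\<chi> i. if i = j then z $ j else z $ i) = z"
      by (simp add: vec_eq_iff)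
    ultimately have "\<forall>\<^sub>F w in at (z $ j). (\<chi> i. if i = j then w else z $ i) \<in> U"
      using topological_tendstoD[OF _ assms(1)] assms(2) by simp
    then show ?thesis
      unfolding eventually_nhds_conv_at using z assms(2) by simp
  qed
  have "partial_deriv 1 \<phi> z = deriv (\<lambda>w. a * w + b (z $ 2)) (z $ 1)"
    unfolding partial_deriv_def
    by (rule deriv_cong_ev[OF eventually_mono[OF ev[of 1]] refl]) (simp add: assms(3))
  also have "\<dots> = a"
    by (rule DERIV_imp_deriv) (auto intro!: derivative_eq_intros)
  finally show "partial_deriv 1 \<phi> z = a" .
  have "partial_deriv 2 \<phi> z = deriv (\<lambda>w. a * z $ 1 + b w) (z $ 2)"
    unfolding partial_deriv_def
    by (rule deriv_cong_ev[OF eventually_mono[OF ev[of 2]] refl]) (simp add: assms(3))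
  also have "\<dots> = deriv b (z $ 2)"
  proof -
    have "((\<lambda>w. a * z $ 1 + b w) has_field_derivative D) (at x) \<longleftrightarrow> (b has_field_derivative D) (at x)"
      for D x
      using DERIV_add[OF DERIV_const[of "a * z $ 1"], of b D x UNIV]
        DERIV_add[OF DERIV_const[of "- a * z $ 1"], of "\<lambda>w. a * z $ 1 + b w" D x UNIV]
      by auto
    then show ?thesis
      by (simp add: deriv_def)
  qed
  finally show "partial_deriv 2 \<phi> z = deriv b (z $ 2)" .
qed

section \<open>The preimage of the differential graph\<close>

theorem proposition5:
  fixes U :: "(complex^2) set" and \<phi> :: "complex^2 \<Rightarrow> complex"
    and a :: complex and b :: "complex \<Rightarrow> complex"
  assumes "open U"
    and "holomorphic_several_on \<phi> U"
    and "b holomorphic_on ((\<lambda>z. z $ 2) ` U)"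
    and "\<And>z. z \<in> U \<Longrightarrow> \<phi> z = a * z $ 1 + b (z $ 2)"
  shows "generalized_solution_PI (G -` differential_graph \<phi> U)"
proof -
  define M where "M = G -` differential_graph \<phi> U"
  define Z :: "cotangent4 \<Rightarrow> complex" where "Z = (\<lambda>x. Complex (fst x $ 3) (fst x $ 4))"
  define P :: "cotangent4 \<Rightarrow> complex" where "P = (\<lambda>x. Complex (snd x $ 3) (- snd x $ 4))"
  \<comment> \<open>The first two components of \<open>G x\<close>; \<open>P x\<close> is the
    fourth.\<close>
  define base :: "cotangent4 \<Rightarrow> complex^2"
    where "base = (\<lambda>x. vector [Complex (snd x $ 1) (- snd x $ 2), Z x])"
  define W where "W = base -` U"
  define T where "T = (\<lambda>z::complex^2. z $ 2) ` U"
  \<comment> \<open>The signs are those of \<open>P\<close>, which reads p3 - i p4: adding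
    \<open>L w\<close> lowers \<open>P\<close> by \<open>w\<close>. Adding \<open>c\<close> raises
    q1 + i q2 by \<open>a\<close>.\<close>
  define L :: "complex \<Rightarrow> cotangent4" where "L = (\<lambda>w. (0, vector [0, 0, - Re w, Im w]))"
  define c :: cotangent4 where "c = (vector [Re a, Im a, 0, 0], 0)"
  define h where "h = (\<lambda>x. c + L (deriv b (Z x)))"
  \<comment> \<open>Directions of q3, q4, p1, p2. Their span \<open>S\<close> is phrased as the
    vanishing of the other coordinates, to suit \<open>subspace_substandard\<close> and
    \<open>dim_substandard\<close>.\<close>
  define d :: "cotangent4 set"
    where "d = {(axis 3 1, 0), (axis 4 1, 0), (0, axis 1 1), (0, axis 2 1)}"
  define S where "S = {x :: cotangent4. \<forall>i\<in>Basis. i \<notin> d \<longrightarrow> x \<bullet> i = 0}"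
  note vec_simps = vec_eq_iff forall_4 forall_2 vector_4

  have "open T"
    unfolding T_def using open_image_vec_nth[OF \<open>open U\<close>] .
  have b': "deriv b holomorphic_on T"
    using assms(3) \<open>open T\<close> unfolding T_def by (rule holomorphic_deriv)
  have Z: "bounded_linear Z"
    unfolding linear_conv_bounded_linear[symmetric] Z_def
    by (rule linearI) (simp_all add: complex_eq_iff)
  have P: "bounded_linear P"
    unfolding linear_conv_bounded_linear[symmetric] P_def
    by (rule linearI) (simp_all add: complex_eq_iff)
  have "linear base"
    unfolding base_def Z_def by (rule linearI) (simp_all add: vec_simps complex_eq_iff)
  then have "open W"
    unfolding W_def linear_conv_bounded_linear
    using \<open>open U\<close> by (intro open_vimage linear_continuous_on)
  have ZT: "Z x \<in> T" if "x \<in> W" for x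
    using that unfolding W_def T_def base_def
    by (intro image_eqI[of _ _ "base x"]) (auto simp: vector_2 base_def)

  have M: "x \<in> M \<longleftrightarrow> x \<in> W \<and> fst x $ 1 = - Re a \<and> fst x $ 2 = - Im a \<and> P x = deriv b (Z x)" for x
  proof -
    \<comment> \<open>The first two components force \<open>z = base x\<close>; the last two become
      the equations of \<open>M\<close>.\<close>
    have "G x = vector [z $ 1, z $ 2, u, v] \<longleftrightarrow>
        z = base x \<and> Complex (- fst x $ 1) (- fst x $ 2) = u \<and> P x = v" for z u v
      by (auto simp: G_def case_prod_beta base_def Z_def P_def vec_simps complex_eq_iff)
    then have "x \<in> M \<longleftrightarrow> (\<exists>z\<in>U. z = base x \<and>
        Complex (- fst x $ 1) (- fst x $ 2) = partial_deriv 1 \<phi> z \<and> P x = partial_deriv 2 \<phi> z)"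
      unfolding M_def differential_graph_def by auto
    also have "\<dots> \<longleftrightarrow> (\<exists>z\<in>U. z = base x \<and> Complex (- fst x $ 1) (- fst x $ 2) = a
        \<and> P x = deriv b (z $ 2))"
      using partial_deriv_affine_first[OF \<open>open U\<close> _ assms(4)] by auto
    finally show ?thesis
      by (auto simp: W_def base_def vector_2 complex_eq_iff)
  qed

  have "embedded_submanifold 4 M"
  proof (rule embedded_submanifold_shear[OF \<open>open W\<close>, where h = h and S = S])
    show "M \<subseteq> W" using M by auto
    have "bounded_linear L"
      unfolding linear_conv_bounded_linear[symmetric] L_def
      by (rule linearI) (simp_all add: vec_simps)
    moreover have "Ck_on k (\<lambda>x. deriv b (Z x)) W" for k
      using ZT by (intro Ck_on_holomorphic_linear[OF \<open>open W\<close> \<open>open T\<close> Z _ b']) auto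
    ultimately show "smooth_on h W"
      unfolding smooth_on_def h_def
      using Ck_on_add[OF \<open>open W\<close> Ck_on_const[OF \<open>open W\<close>] Ck_on_bounded_linear_compose[OF \<open>open W\<close>]]
      by blast
    show "subspace S"
      unfolding S_def by (rule subspace_substandard)
    have "d \<subseteq> Basis"
      by (auto simp: d_def Basis_prod_def axis_in_Basis_iff)
    then show "dim S = 4"
      unfolding S_def by (subst dim_substandard) (auto simp: d_def axis_eq_axis axis_eq_0_iff)
    have S: "x \<in> S \<longleftrightarrow> fst x $ 1 = 0 \<and> fst x $ 2 = 0 \<and> snd x $ 3 = 0 \<and> snd x $ 4 = 0" for x
      unfolding S_def
      by (auto simp: d_def Basis_prod_def Basis_vec_def inner_axis axis_eq_axis axis_eq_0_iff
          inner_prod_def ball_Un forall_4)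
    show "x \<in> M \<longleftrightarrow> x + h x \<in> S" if "x \<in> W" for x
      using that
      by (auto simp: M S h_def c_def L_def P_def complex_eq_iff vector_4)
    \<comment> \<open>\<open>h\<close> moves only q1, q2, p3, p4, while \<open>base\<close> and
      \<open>Z\<close> read only q3, q4, p1, p2.\<close>
    have inv: "base (x + h y) = base x" "base (x - h y) = base x"
      "Z (x + h y) = Z x" "Z (x - h y) = Z x" for x y
      by (simp_all add: base_def Z_def h_def c_def L_def vec_simps)
    have "h (x + h y) = h x" "h (x - h y) = h x" for x y
      \<comment> \<open>Only the outer \<open>h\<close> is expanded; the shift \<open>h y\<close>
        stays folded so that \<open>inv\<close> still matches.\<close>
      unfolding h_def[THEN fun_cong, of "x + h y"] h_def[THEN fun_cong, of "x - h y"] inv(3,4)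
      by (simp_all add: h_def)
    then show "x + h x \<in> W \<and> h (x + h x) = h x" "x - h x \<in> W \<and> h (x - h x) = h x" if "x \<in> W" for x
      using that inv(1,2) by (simp_all add: W_def)
  qed

  have tangent: "fst v $ 1 = 0" "fst v $ 2 = 0" "P v = deriv (deriv b) (Z x) * Z v"
    if "x \<in> M" "v \<in> tangent_space M x" for x v
  proof -
    note eq = tangent_space_derivative_eq[OF that(2,1)]
    have comp: "((\<lambda>y. fst y $ i) has_derivative (\<lambda>y. fst y $ i)) (at x)" for i
      by (intro bounded_linear_imp_has_derivative bounded_linear_compose[OF bounded_linear_vec_nth bounded_linear_fst])
    show "fst v $ 1 = 0" "fst v $ 2 = 0"
      using eq[OF _ comp has_derivative_const] M by blast+
    have "(deriv b has_field_derivative deriv (deriv b) (Z x)) (at (Z x))"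
      using holomorphic_derivI[OF b' \<open>open T\<close> ZT] M that(1) by blast
    then have "(deriv b has_derivative (*) (deriv (deriv b) (Z x))) (at (Z x))"
      by (simp add: has_field_derivative_def)
    note has_derivative_compose[OF bounded_linear_imp_has_derivative[OF Z] this]
    from eq[OF _ bounded_linear_imp_has_derivative[OF P] this]
    show "P v = deriv (deriv b) (Z x) * Z v"
      using M by blast
  qed

  have "restricts_to_zero 2 Omega M"
    unfolding restricts_to_zero_def
  proof (intro ballI allI impI, elim conjE)
    fix x vs assume x: "x \<in> M" and vs: "length vs = 2" "set vs \<subseteq> tangent_space M x"
    from vs obtain v w where "vs = [v, w]"
      by (auto simp: length_Suc_conv numeral_2_eq_2)
    with vs have v: "v \<in> tangent_space M x" and w: "w \<in> tangent_space M x" by auto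
    note tv = tangent[OF x v] and tw = tangent[OF x w]
    \<comment> \<open>On tangent vectors (p3, p4) depends on (q3, q4) through the matrix with rows
      (r, -s) and (-s, -r). Its symmetry makes the remaining terms of \<open>Omega\<close>
      cancel.\<close>
    obtain r s where rs: "deriv (deriv b) (Z x) = Complex r s" by (cases "deriv (deriv b) (Z x)")
    have "snd v $ 3 = r * fst v $ 3 - s * fst v $ 4" "snd v $ 4 = - (r * fst v $ 4 + s * fst v $ 3)"
      using tv(3)[unfolded rs] by (auto simp: P_def Z_def complex_eq_iff)
    moreover have "snd w $ 3 = r * fst w $ 3 - s * fst w $ 4" "snd w $ 4 = - (r * fst w $ 4 + s * fst w $ 3)"
      using tw(3)[unfolded rs] by (auto simp: P_def Z_def complex_eq_iff)
    ultimately show "Omega vs = 0"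
      using tv(1,2) tw(1,2)
      by (simp add: Omega_def sum_4 wedge_2 dq_def dp_def \<open>vs = [v, w]\<close>) (simp add: algebra_simps)
  qed
  moreover have "restricts_to_zero 4 omega_PI M"
    unfolding restricts_to_zero_def
  proof (intro ballI allI impI, elim conjE)
    fix x vs assume x: "x \<in> M" and vs: "length vs = 4" "set vs \<subseteq> tangent_space M x"
    have "dq 1 v = 0" if "v \<in> set vs" for v
      unfolding dq_def using tangent(1)[OF x] vs(2) that by blast
    \<comment> \<open>Both terms of \<open>omega_PI\<close> have this shape.\<close>
    with vs(1) have "wedge [dq 1, dq 2, \<alpha>, \<beta>] vs = 0" for \<alpha> \<beta>
      by (intro wedge_eq_0[where \<alpha> = "dq 1"]) auto
    then show "omega_PI vs = 0"
      by (simp add: omega_PI_def)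
  qed
  ultimately show ?thesis
    using \<open>embedded_submanifold 4 M\<close>
    by (simp add: generalized_solution_PI_def lagrangian_submanifold_def M_def)
qed

end
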